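(* Let $d\in\{1,2\}$, $\varepsilon>0$, $f\in L^2(\mathbb{R}^d)$, and let the ship velocity be constant, $\boldsymbol U(t)=U_x\boldsymbol{e_x}$ with $U_x\in\mathbb{R}$, with position $X(t)=U_x t\,\boldsymbol{e_x}$. Then the stationary solution to $$\frac{d\hat\mu_{\boldsymbol\kappa,\varepsilon}}{dt}(t)=i\omega_{\boldsymbol\kappa,\varepsilon}\hat\mu_{\boldsymbol\kappa,\varepsilon}(t)-\hat g_{\boldsymbol\kappa}(t)$$ is given by $$\hat\mu^\star_{\boldsymbol\kappa,\varepsilon}(t)=\frac{D_{\boldsymbol\kappa}}{i(2\pi\kappa_xU_x+\omega_{\boldsymbol\kappa,\varepsilon})}e^{-2\pi i\kappa_xU_xt},\qquad D_{\boldsymbol\kappa}=\frac{2\pi\rho_1\,i\,\kappa_xU_x\hat f_{\boldsymbol\kappa}}{\sinh(2\pi|\boldsymbol\kappa|_2h_1)(T_{1,\boldsymbol\kappa}+T_{2,\boldsymbol\kappa})}.$$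
   Context: Constants: $0<\rho_1<\rho_2$, $h_1,h_2>0$, $g>0$ (gravitational acceleration). $|\cdot|_2$ is the Euclidean norm; $\kappa_x$ is the first component of $\boldsymbol\kappa\in\mathbb{R}^d$ ($\boldsymbol\kappa=\kappa_x$ if $d=1$) and $\boldsymbol{e_x}$ is the unit vector of the $x$-axis. For $\boldsymbol\kappa\ne0$, $$T_{j,\boldsymbol\kappa}=\rho_j\coth(2\pi|\boldsymbol\kappa|_2h_j)\ (j=1,2),\qquad \omega_{\boldsymbol\kappa}=\sqrt{\frac{2\pi|\boldsymbol\kappa|_2(\rho_2-\rho_1)g}{T_{1,\boldsymbol\kappa}+T_{2,\boldsymbol\kappa}}},\qquad \omega_{\boldsymbol\kappa,\varepsilon}=\omega_{\boldsymbol\kappa}+i\varepsilon .$$ $\hat f_{\boldsymbol\kappa}=\int_{\mathbb{R}^d}f(\boldsymbol x)e^{-2\pi i\boldsymbol\kappa\cdot\boldsymbol x}d\boldsymbol x$ is the Fourier transform (extended to $L^2$). The source term is $$\hat g_{\boldsymbol\kappa}(t)=\frac{2\pi\rho_1\, i\,\boldsymbol\kappa\cdot\boldsymbol U(t)\,e^{-2\pi i\boldsymbol\kappa\cdot X(t)}\hat f_{\boldsymbol\kappa}}{\sinh(2\pi|\boldsymbol\kappa|_2h_1)(T_{1,\boldsymbol\kappa}+T_{2,\boldsymbol\kappa})}.$$ A solution with initial value in $L^2(\mathbb{R}^d)$ means a function satisfying, for $t\ge0$ and a.e. $\boldsymbol\kappa$, Duhamel's formula $\hat\mu_{\boldsymbol\kappa,\varepsilon}(t)=\hat\mu_{\boldsymbol\kappa,\varepsilon}(0)e^{i\omega_{\boldsymbol\kappa,\varepsilon}t}-\int_0^te^{i\omega_{\boldsymbol\kappa,\varepsilon}(t-\tau)}\hat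 g_{\boldsymbol\kappa}(\tau)d\tau$. "Stationary" means steady in the ship's frame of reference, i.e. the inverse Fourier transform at time $t$ is the translate by $U_xt\,\boldsymbol{e_x}$ of the one at time $0$; equivalently $\hat\mu_{\boldsymbol\kappa,\varepsilon}(t)=\hat\mu_{\boldsymbol\kappa,\varepsilon}(0)e^{-2\pi i\kappa_xU_xt}$. *)

theory Defs
  imports "HOL-Analysis.Analysis"
begin

section \<open>Square-integrable functions and their Fourier transform\<close>

definition L2 :: "('a::euclidean_space \<Rightarrow> complex) \<Rightarrow> bool" where
  "L2 f \<longleftrightarrow> f \<in> borel_measurable lebesgue \<and> integrable lebesgue (\<lambda>x. (norm (f x))\<^sup>2)"

definition sq_dist :: "('a::euclidean_space \<Rightarrow> complex) \<Rightarrow> ('a \<Rightarrow> complex) \<Rightarrow> ennreal" where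
  "sq_dist f g = (\<integral>\<^sup>+x. ennreal ((norm (f x - g x))\<^sup>2) \<partial>lebesgue)"

definition fourier :: "('a::euclidean_space \<Rightarrow> complex) \<Rightarrow> 'a \<Rightarrow> complex" where
  "fourier f \<kappa> = (\<integral>x. f x * exp (- 2 * pi * \<i> * complex_of_real (\<kappa> \<bullet> x)) \<partial>lebesgue)"

text \<open>
  The transform on \<open>L\<^sup>2\<close> is the continuous extension of the integral from
  \<open>L\<^sup>1 \<inter> L\<^sup>2\<close>. It is only determined up to null sets, so it is
  a relation: \<open>F\<close> is a representative of the transform of \<open>f\<close>.
\<close>

definition fourier_L2 :: "('a::euclidean_space \<Rightarrow> complex) \<Rightarrow> ('a \<Rightarrow> complex) \<Rightarrow> bool" where
  "fourier_L2 f F \<longleftrightarrow> L2 f \<and> L2 F \<and>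
     (\<exists>s :: nat \<Rightarrow> 'a \<Rightarrow> complex.
        (\<forall>n. integrable lebesgue (s n) \<and> L2 (s n)) \<and>
        (\<lambda>n. sq_dist (s n) f) \<longlonglongrightarrow> 0 \<and>
        (\<lambda>n. sq_dist (fourier (s n)) F) \<longlonglongrightarrow> 0)"


section \<open>Dispersion relation and source term\<close>

text \<open>
  At \<open>\<kappa> = 0\<close>, where the formulas are not meant to be used, the definitions below take
  the values given by \<open>x / 0 = 0\<close>; this is a null set of frequencies.
\<close>

definition coth :: "real \<Rightarrow> real" where
  "coth x = cosh x / sinh x"

definition T :: "real \<Rightarrow> real \<Rightarrow> 'a::euclidean_space \<Rightarrow> real" where
  "T \<rho> h \<kappa> = \<rho> * coth (2 * pi * norm \<kappa> * h)"

definition omega :: "real \<Rightarrow> real \<Rightarrow> real \<Rightarrow> real \<Rightarrow> real \<Rightarrow> 'a::euclidean_space \<Rightarrow> real" where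
  "omega \<rho>1 \<rho>2 h1 h2 g \<kappa> =
     sqrt (2 * pi * norm \<kappa> * (\<rho>2 - \<rho>1) * g / (T \<rho>1 h1 \<kappa> + T \<rho>2 h2 \<kappa>))"

definition omega_eps ::
  "real \<Rightarrow> real \<Rightarrow> real \<Rightarrow> real \<Rightarrow> real \<Rightarrow> real \<Rightarrow> 'a::euclidean_space \<Rightarrow> complex" where
  "omega_eps \<rho>1 \<rho>2 h1 h2 g \<epsilon> \<kappa> =
     complex_of_real (omega \<rho>1 \<rho>2 h1 h2 g \<kappa>) + \<i> * complex_of_real \<epsilon>"

text \<open>\<open>U\<close> is the velocity of the ship, \<open>X\<close> its position and \<open>F\<close> the Fourier transform of \<open>f\<close>.\<close>

definition source ::
  "real \<Rightarrow> real \<Rightarrow> real \<Rightarrow> real \<Rightarrow> (real \<Rightarrow> 'a) \<Rightarrow> (real \<Rightarrow> 'a) \<Rightarrow> ('a \<Rightarrow> complex)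
     \<Rightarrow> real \<Rightarrow> 'a::euclidean_space \<Rightarrow> complex" where
  "source \<rho>1 \<rho>2 h1 h2 U X F t \<kappa> =
     2 * pi * \<rho>1 * \<i> * complex_of_real (\<kappa> \<bullet> U t)
       * exp (- 2 * pi * \<i> * complex_of_real (\<kappa> \<bullet> X t)) * F \<kappa>
       / complex_of_real (sinh (2 * pi * norm \<kappa> * h1) * (T \<rho>1 h1 \<kappa> + T \<rho>2 h2 \<kappa>))"

text \<open>The coordinate \<open>ix\<close> is the one of the x-axis.\<close>

definition D ::
  "real \<Rightarrow> real \<Rightarrow> real \<Rightarrow> real \<Rightarrow> 'n \<Rightarrow> real \<Rightarrow> (real^'n \<Rightarrow> complex) \<Rightarrow> real^'n::finite \<Rightarrow> complex"
  where
  "D \<rho>1 \<rho>2 h1 h2 ix Ux F \<kappa> =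
     2 * pi * \<rho>1 * \<i> * complex_of_real (\<kappa> $ ix) * complex_of_real Ux * F \<kappa>
       / complex_of_real (sinh (2 * pi * norm \<kappa> * h1) * (T \<rho>1 h1 \<kappa> + T \<rho>2 h2 \<kappa>))"


section \<open>Stationary solutions\<close>

text \<open>
  Solutions of \<open>\<mu>' = \<i> \<omega> \<mu> - G\<close> with initial value in \<open>L\<^sup>2\<close>, in
  the sense of Duhamel's formula; functions of \<open>\<kappa>\<close> are identified when they agree
  almost everywhere.
\<close>

definition duhamel_solution ::
  "('a::euclidean_space \<Rightarrow> complex) \<Rightarrow> (real \<Rightarrow> 'a \<Rightarrow> complex) \<Rightarrow> (real \<Rightarrow> 'a \<Rightarrow> complex) \<Rightarrow> bool"
  where
  "duhamel_solution w G \<mu> \<longleftrightarrow> L2 (\<mu> 0) \<and>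
     (\<forall>t\<ge>0. AE \<kappa> in lebesgue.
        \<mu> t \<kappa> = \<mu> 0 \<kappa> * exp (\<i> * w \<kappa> * complex_of_real t)
          - integral {0..t} (\<lambda>\<tau>. exp (\<i> * w \<kappa> * complex_of_real (t - \<tau>)) * G \<tau> \<kappa>))"

text \<open>
  Steady in the frame moving with velocity \<open>Ux\<close> along the x-axis, expressed for the Fourier
  transforms; the lemma after the definition gives the meaning for the functions themselves.
\<close>

definition stationary :: "'n \<Rightarrow> real \<Rightarrow> (real \<Rightarrow> real^'n::finite \<Rightarrow> complex) \<Rightarrow> bool" where
  "stationary ix Ux \<mu> \<longleftrightarrow>
     (\<forall>t\<ge>0. AE \<kappa> in lebesgue.
        \<mu> t \<kappa> = \<mu> 0 \<kappa> * exp (- 2 * pi * \<i> * complex_of_real (\<kappa> $ ix * Ux * t)))"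

lemma measurable_lebesgue_diff:
  "(\<lambda>x::'a::euclidean_space. x - a) \<in> lebesgue \<rightarrow>\<^sub>M lebesgue"
proof (rule measurableI)
  fix A :: "'a set" assume A: "A \<in> sets lebesgue"
  have "(\<lambda>x. x - a) -` A \<inter> space lebesgue = (\<lambda>x. x + a) ` A"
    by (auto simp: image_iff) (metis diff_add_cancel)
  then show "(\<lambda>x. x - a) -` A \<inter> space lebesgue \<in> sets lebesgue"
    using lebesgue_sets_translation[OF A, of a] by (simp add: add.commute)
qed simp

lemma distr_lebesgue_diff:
  "distr lebesgue lebesgue (\<lambda>x::'a::euclidean_space. x - a) = lebesgue"
proof (rule measure_eqI)
  fix A :: "'a set" assume "A \<in> sets (distr lebesgue lebesgue (\<lambda>x. x - a))"
  then have A: "A \<in> sets lebesgue" by simp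
  have "(\<lambda>x. x - a) -` A \<inter> space lebesgue = (\<lambda>x. a + 1 *\<^sub>R x) ` A"
    by (auto simp: image_iff) (metis add.commute diff_add_cancel)
  then show "emeasure (distr lebesgue lebesgue (\<lambda>x. x - a)) A = emeasure lebesgue A"
    using emeasure_lebesgue_affine[of 1 a A]
    by (simp add: emeasure_distr[OF measurable_lebesgue_diff A] add.commute cong: image_cong_simp)
qed simp

lemma L2_translate:
  assumes "L2 f" shows "L2 (\<lambda>x. f (x - a))"
proof -
  have m: "f \<in> borel_measurable lebesgue" and i: "integrable lebesgue (\<lambda>x. (norm (f x))\<^sup>2)"
    using assms by (auto simp: L2_def)
  have "(\<lambda>x. f (x - a)) \<in> borel_measurable lebesgue"
    using measurable_compose[OF measurable_lebesgue_diff m] .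
  moreover have "integrable lebesgue (\<lambda>x. (norm (f (x - a)))\<^sup>2)"
    by (rule integrable_distr[OF measurable_lebesgue_diff]) (use i in \<open>simp add: distr_lebesgue_diff\<close>)
  ultimately show ?thesis by (simp add: L2_def)
qed

lemma sq_dist_translate:
  assumes "L2 f" "L2 g"
  shows "sq_dist (\<lambda>x. f (x - a)) (\<lambda>x. g (x - a)) = sq_dist f g"
proof -
  have "(\<lambda>x. ennreal ((norm (f x - g x))\<^sup>2)) \<in> borel_measurable lebesgue"
    using assms by (auto simp: L2_def)
  then have "(\<lambda>x. ennreal ((norm (f x - g x))\<^sup>2))
      \<in> borel_measurable (distr lebesgue lebesgue (\<lambda>x. x - a))"
    by simp
  from nn_integral_distr[OF measurable_lebesgue_diff this] show ?thesis
    by (simp add: sq_dist_def distr_lebesgue_diff)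
qed

lemma borel_measurable_lebesgue_continuous:
  fixes f :: "'a::euclidean_space \<Rightarrow> complex"
  assumes "continuous_on UNIV f" shows "f \<in> borel_measurable lebesgue"
proof -
  have "f \<in> borel_measurable lborel"
    using borel_measurable_continuous_onI[OF assms] by simp
  then show ?thesis by (rule measurable_completion)
qed

lemma fourier_translate:
  assumes "integrable lebesgue f"
  shows "fourier (\<lambda>x. f (x - a)) \<kappa>
    = fourier f \<kappa> * exp (- 2 * pi * \<i> * complex_of_real (\<kappa> \<bullet> a))"
proof -
  define e where "e = (\<lambda>x. exp (- 2 * pi * \<i> * complex_of_real (\<kappa> \<bullet> x)))"
  have e: "e (x + y) = e x * e y" for x y
    by (simp add: e_def exp_add[symmetric] algebra_simps)
  have "e \<in> borel_measurable lebesgue"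
    unfolding e_def by (intro borel_measurable_lebesgue_continuous continuous_intros)
  then have m: "(\<lambda>x. f x * e (x + a)) \<in> borel_measurable lebesgue"
    using assms by (auto simp: e)
  have "fourier (\<lambda>x. f (x - a)) \<kappa> = (\<integral>x. f (x - a) * e ((x - a) + a) \<partial>lebesgue)"
    by (simp add: fourier_def e_def)
  also have "\<dots> = (\<integral>x. f x * e (x + a) \<partial>distr lebesgue lebesgue (\<lambda>x. x - a))"
    by (rule integral_distr[OF measurable_lebesgue_diff m, symmetric])
  also have "\<dots> = (\<integral>x. f x * e x * e a \<partial>lebesgue)"
    by (simp add: distr_lebesgue_diff e mult.assoc)
  also have "\<dots> = fourier f \<kappa> * e a"
    by (simp add: fourier_def e_def)
  finally show ?thesis by (simp add: e_def)
qed

lemma fourier_L2_translate: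
  assumes fF: "fourier_L2 f F"
    and G: "AE \<kappa> in lebesgue. G \<kappa> = F \<kappa> * exp (- 2 * pi * \<i> * complex_of_real (\<kappa> \<bullet> a))"
  shows "fourier_L2 (\<lambda>x. f (x - a)) G"
proof -
  let ?e = "\<lambda>\<kappa>. exp (- 2 * pi * \<i> * complex_of_real (\<kappa> \<bullet> a))"
  have ne: "norm (?e \<kappa>) = 1" for \<kappa> by simp
  from fF obtain s where f: "L2 f" and F: "L2 F"
    and s: "\<And>n. integrable lebesgue (s n)" "\<And>n. L2 (s n)"
    and l1: "(\<lambda>n. sq_dist (s n) f) \<longlonglongrightarrow> 0"
    and l2: "(\<lambda>n. sq_dist (fourier (s n)) F) \<longlonglongrightarrow> 0"
    by (auto simp: fourier_L2_def)
  have me: "?e \<in> borel_measurable lebesgue"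
    by (intro borel_measurable_lebesgue_continuous continuous_intros)
  have Fm: "F \<in> borel_measurable lebesgue" using F by (simp add: L2_def)
  have Gm: "G \<in> borel_measurable lebesgue"
  proof (rule borel_measurable_AE[of "\<lambda>\<kappa>. F \<kappa> * ?e \<kappa>"])
    show "AE \<kappa> in lebesgue. F \<kappa> * ?e \<kappa> = G \<kappa>" using G by (auto simp: eq_commute)
  qed (use Fm me in auto)
  have "integrable lebesgue (\<lambda>\<kappa>. (norm (G \<kappa>))\<^sup>2) \<longleftrightarrow> integrable lebesgue (\<lambda>\<kappa>. (norm (F \<kappa>))\<^sup>2)"
    by (rule integrable_cong_AE) (use Gm Fm G in \<open>auto simp: norm_mult\<close>)
  then have LG: "L2 G" using Gm F by (simp add: L2_def)
  have d: "sq_dist (fourier (\<lambda>x. s n (x - a))) G = sq_dist (fourier (s n)) F" for n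
    unfolding sq_dist_def
  proof (rule nn_integral_cong_AE, use G in eventually_elim)
    case (elim \<kappa>)
    have "fourier (\<lambda>x. s n (x - a)) \<kappa> - G \<kappa> = (fourier (s n) \<kappa> - F \<kappa>) * ?e \<kappa>"
      by (simp only: fourier_translate[OF s(1)] elim left_diff_distrib)
    then show ?case by (simp only: norm_mult ne mult_1_right)
  qed
  have i: "integrable lebesgue (\<lambda>x. s n (x - a))" for n
    by (rule integrable_distr[OF measurable_lebesgue_diff]) (use s in \<open>simp add: distr_lebesgue_diff\<close>)
  show ?thesis
    unfolding fourier_L2_def
    by (intro conjI exI[of _ "\<lambda>n x. s n (x - a)"] allI)
      (use f s l1 l2 LG i in \<open>simp_all add: L2_translate sq_dist_translate d\<close>)
qed

lemma stationary_imp_translate: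
  fixes \<mu> :: "real \<Rightarrow> real^'n \<Rightarrow> complex"
  assumes "stationary ix Ux \<mu>" "fourier_L2 u (\<mu> 0)" "0 \<le> t"
  shows "fourier_L2 (\<lambda>x. u (x - (Ux * t) *\<^sub>R axis ix 1)) (\<mu> t)"
  using assms
  by (intro fourier_L2_translate[where F = "\<mu> 0"]) (auto simp: stationary_def inner_axis mult_ac)

end

theory Submission
  imports Defs
begin

text \<open>
  In the ship's frame the source is a single oscillation \<open>D e\<^sup>-\<^sup>i\<^sup>a\<^sup>t\<close> with
  \<open>a = 2\<pi>\<kappa>\<^sub>xU\<^sub>x\<close>, and the Duhamel integral is elementary. Since the imaginary part
  \<open>\<epsilon>\<close> of the frequency is positive, \<open>a + \<omega>\<close> never vanishes and the free oscillation is damped,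
  so the stationarity condition at time \<open>1\<close> alone determines the initial value. That value is in
  \<open>L\<^sup>2\<close> because \<open>\<bar>D\<bar> \<le> \<bar>U\<^sub>x\<bar> \<bar>F\<bar> / h\<^sub>1\<close>, which follows from
  \<open>sinh x coth x = cosh x \<ge> x\<close>.
\<close>

text \<open>With c = \<i> (a + w) the integrand collapses to d exp(\<i> w t) exp(- c \<tau>), a
  single exponential in \<tau>; nonresonance a + w \<noteq> 0 is what allows division by c.\<close>

lemma integral_duhamel_oscillation:
  fixes w d :: complex and a t :: real
  assumes "complex_of_real a + w \<noteq> 0" "0 \<le> t"
  shows "integral {0..t} (\<lambda>\<tau>. exp (\<i> * w * complex_of_real (t - \<tau>)) * (d * exp (- \<i> * complex_of_real (a * \<tau>))))
    = d / (\<i> * (complex_of_real a + w)) * (exp (\<i> * w * complex_of_real t) - exp (- \<i> * complex_of_real (a * t)))"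
proof -
  define c where "c = \<i> * (complex_of_real a + w)"
  have c: "c \<noteq> 0" using assms by (simp add: c_def)
  \<comment> \<open>The antiderivative is taken on the complex plane, so that the field derivative
    rules apply before restricting to real \<tau>.\<close>
  define P where "P = (\<lambda>z. - (d / c) * exp (\<i> * w * complex_of_real t - c * z))"
  have "((\<lambda>\<tau>. d * exp (\<i> * w * complex_of_real t - c * complex_of_real \<tau>)) has_integral
      P (complex_of_real t) - P (complex_of_real 0)) {0..t}"
  proof (rule fundamental_theorem_of_calculus[OF assms(2)])
    fix \<tau> :: real
    have "(P has_field_derivative d * exp (\<i> * w * complex_of_real t - c * complex_of_real \<tau>))
        (at (complex_of_real \<tau>))"
      unfolding P_def using c by (auto intro!: derivative_eq_intros simp: field_simps)
    then show "((\<lambda>\<tau>. P (complex_of_real \<tau>)) has_vector_derivative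
        d * exp (\<i> * w * complex_of_real t - c * complex_of_real \<tau>)) (at \<tau> within {0..t})"
      by (rule has_vector_derivative_real_field)
  qed
  moreover have "exp (\<i> * w * complex_of_real (t - \<tau>)) * (d * exp (- \<i> * complex_of_real (a * \<tau>)))
      = d * exp (\<i> * w * complex_of_real t - c * complex_of_real \<tau>)" for \<tau>
  proof -
    have "\<i> * w * complex_of_real t - c * complex_of_real \<tau>
        = \<i> * w * complex_of_real (t - \<tau>) + - \<i> * complex_of_real (a * \<tau>)"
      by (simp add: c_def algebra_simps)
    then show ?thesis by (simp only: exp_add mult_ac)
  qed
  \<comment> \<open>At the upper endpoint \<open>w\<close> cancels and only the phase of the source
    remains.\<close>
  moreover have "\<i> * w * complex_of_real t - c * complex_of_real t = - \<i> * complex_of_real (a * t)"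
    by (simp add: c_def algebra_simps)
  then have "P (complex_of_real t) - P (complex_of_real 0)
      = d / c * (exp (\<i> * w * complex_of_real t) - exp (- \<i> * complex_of_real (a * t)))"
    unfolding P_def by (simp only: of_real_0 mult_zero_right diff_zero) (simp add: right_diff_distrib)
  ultimately show ?thesis unfolding c_def[symmetric] by (simp only: integral_unique)
qed

text \<open>This supplies the linear growth that compensates the factor \<open>\<kappa> $ ix\<close>
  in \<open>D\<close>.\<close>

lemma cosh_ge_self: "x \<le> cosh (x::real)"
proof (cases "0 \<le> x")
  case True
  \<comment> \<open>The difference of the two sides is ((x - 1)^2 + 1) / 2.\<close>
  have "2 * x \<le> 1 + x + x\<^sup>2 / 2"
    using zero_le_power2[of "x - 1"] by (simp add: power2_diff)
  also have "\<dots> \<le> exp x + exp (- x)"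
    using exp_lower_Taylor_quadratic[OF True] exp_gt_zero[of "- x"] by linarith
  finally show ?thesis by (simp add: cosh_def)
next
  case False
  then show ?thesis using cosh_real_pos[of x] by linarith
qed

text \<open>The numerator grows at most linearly in \<open>norm \<kappa>\<close> relative to
  \<open>F\<close>, while the denominator is at least \<rho>1 x with x proportional to
  \<open>norm \<kappa>\<close>. So \<open>D\<close> is \<open>F\<close> times a bounded
  multiplier.\<close>

lemma norm_D_le:
  fixes \<kappa> :: "real^'n::finite"
  assumes "0 < \<rho>1" "0 < \<rho>2" "0 < h1" "0 < h2"
  shows "norm (D \<rho>1 \<rho>2 h1 h2 ix Ux F \<kappa>) \<le> \<bar>Ux\<bar> / h1 * norm (F \<kappa>)"
proof (cases "\<kappa> = 0")
  case True
  then show ?thesis using assms by (simp add: D_def)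
next
  case False
  define x where "x = 2 * pi * norm \<kappa> * h1"
  define S where "S = sinh x * (T \<rho>1 h1 \<kappa> + T \<rho>2 h2 \<kappa>)"
  have x: "0 < x" using False assms by (simp add: x_def)
  \<comment> \<open>The second layer only enlarges \<open>S\<close>; the first layer alone gives the
    lower bound.\<close>
  have "0 \<le> sinh x * T \<rho>2 h2 \<kappa>"
    using x False assms by (simp add: T_def coth_def)
  moreover have "sinh x * T \<rho>1 h1 \<kappa> = \<rho>1 * cosh x"
    using x by (simp add: T_def coth_def flip: x_def)
  moreover have "\<rho>1 * x \<le> \<rho>1 * cosh x"
    using assms cosh_ge_self by simp
  ultimately have S: "\<rho>1 * x \<le> S"
    by (simp add: S_def distrib_left)
  have pos: "0 < \<rho>1 * x" using assms x by simp
  have "norm (D \<rho>1 \<rho>2 h1 h2 ix Ux F \<kappa>) = 2 * pi * \<rho>1 * \<bar>\<kappa> $ ix\<bar> * \<bar>Ux\<bar> * norm (F \<kappa>) / S"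
  proof -
    have "D \<rho>1 \<rho>2 h1 h2 ix Ux F \<kappa>
        = 2 * pi * \<rho>1 * \<i> * complex_of_real (\<kappa> $ ix) * complex_of_real Ux * F \<kappa> / complex_of_real S"
      by (simp only: D_def S_def x_def)
    then show ?thesis
      using assms pos S by (simp add: norm_mult norm_divide)
  qed
  also have "\<dots> \<le> 2 * pi * \<rho>1 * norm \<kappa> * \<bar>Ux\<bar> * norm (F \<kappa>) / (\<rho>1 * x)"
    using assms S pos component_le_norm_cart[of \<kappa> ix]
    by (intro frac_le mult_right_mono mult_left_mono) auto
  also have "\<dots> = \<bar>Ux\<bar> / h1 * norm (F \<kappa>)"
    using False assms by (simp add: x_def)
  finally show ?thesis .
qed

lemma L2_bounded_by:
  assumes "L2 F" "G \<in> borel_measurable lebesgue" "\<And>x. norm (G x) \<le> C * norm (F x)"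
  shows "L2 G"
proof -
  have "integrable lebesgue (\<lambda>x. (norm (G x))\<^sup>2)"
  proof (rule Bochner_Integration.integrable_bound)
    show "integrable lebesgue (\<lambda>x. C\<^sup>2 * (norm (F x))\<^sup>2)"
      using assms(1) by (simp add: L2_def)
    have "(norm (G x))\<^sup>2 \<le> C\<^sup>2 * (norm (F x))\<^sup>2" for x
      using power_mono[OF assms(3)[of x], of 2] by (simp add: power_mult_distrib)
    then show "AE x in lebesgue. norm ((norm (G x))\<^sup>2) \<le> norm (C\<^sup>2 * (norm (F x))\<^sup>2)"
      by simp
  qed (use assms(2) in simp)
  then show ?thesis using assms(2) by (simp add: L2_def)
qed

text \<open>The explicit coefficients are Borel functions, whereas \<open>F\<close> is only Lebesgue
  measurable; the former are moved to the completion before the two are multiplied.\<close>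

lemma measurable_lebesgue_of_borel:
  "f \<in> borel_measurable borel \<Longrightarrow> f \<in> borel_measurable lebesgue"
  by (rule measurable_completion) simp

lemma sinh_measurable [measurable]: "sinh \<in> borel_measurable (borel :: real measure)"
  by (intro borel_measurable_continuous_onI continuous_intros)

lemma cosh_measurable [measurable]: "cosh \<in> borel_measurable (borel :: real measure)"
  by (intro borel_measurable_continuous_onI continuous_intros)

lemma T_measurable [measurable]: "T \<rho> h \<in> borel_measurable borel"
  unfolding T_def coth_def by measurable

lemma omega_eps_measurable: "omega_eps \<rho>1 \<rho>2 h1 h2 g \<epsilon> \<in> borel_measurable lebesgue"
  by (rule measurable_lebesgue_of_borel) (unfold omega_eps_def omega_def, measurable)

lemma D_measurable:
  fixes F :: "real^'n::finite \<Rightarrow> complex"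
  assumes "F \<in> borel_measurable lebesgue"
  shows "D \<rho>1 \<rho>2 h1 h2 ix Ux F \<in> borel_measurable lebesgue"
proof -
  have "(\<lambda>\<kappa>::real^'n. complex_of_real (sinh (2 * pi * norm \<kappa> * h1) * (T \<rho>1 h1 \<kappa> + T \<rho>2 h2 \<kappa>)))
      \<in> borel_measurable lebesgue"
    "(\<lambda>\<kappa>::real^'n. complex_of_real (\<kappa> $ ix)) \<in> borel_measurable lebesgue"
    by (rule measurable_lebesgue_of_borel, measurable)+
  then show ?thesis
    unfolding D_def using assms by (intro borel_measurable_divide borel_measurable_times) auto
qed

theorem proposition11:
  fixes \<rho>1 \<rho>2 h1 h2 g \<epsilon> Ux :: real
    and ix :: "'n::finite"
    and f F :: "real^'n \<Rightarrow> complex"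
    and U X :: "real \<Rightarrow> real^'n"
    and w :: "real^'n \<Rightarrow> complex"
    and \<mu>_star :: "real \<Rightarrow> real^'n \<Rightarrow> complex"
  assumes "CARD('n) \<in> {1, 2}"
    and "0 < \<rho>1" "\<rho>1 < \<rho>2" "0 < h1" "0 < h2" "0 < g" "0 < \<epsilon>"
    and "L2 f" and "fourier_L2 f F"
  defines "U \<equiv> \<lambda>t. Ux *\<^sub>R axis ix 1"
    and "X \<equiv> \<lambda>t. (Ux * t) *\<^sub>R axis ix 1"
    and "w \<equiv> omega_eps \<rho>1 \<rho>2 h1 h2 g \<epsilon>"
    and "\<mu>_star \<equiv> \<lambda>t \<kappa>.
           D \<rho>1 \<rho>2 h1 h2 ix Ux F \<kappa> / (\<i> * (complex_of_real (2 * pi * (\<kappa> $ ix) * Ux) + w \<kappa>))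
             * exp (- 2 * pi * \<i> * complex_of_real (\<kappa> $ ix * Ux * t))"
  shows "duhamel_solution w (source \<rho>1 \<rho>2 h1 h2 U X F) \<mu>_star
       \<and> stationary ix Ux \<mu>_star
       \<and> (\<forall>\<mu>. duhamel_solution w (source \<rho>1 \<rho>2 h1 h2 U X F) \<mu> \<and> stationary ix Ux \<mu>
              \<longrightarrow> (\<forall>t\<ge>0. AE \<kappa> in lebesgue. \<mu> t \<kappa> = \<mu>_star t \<kappa>))"
proof -
  define a where "a = (\<lambda>\<kappa>::real^'n. 2 * pi * (\<kappa> $ ix) * Ux)"
  define d where "d = D \<rho>1 \<rho>2 h1 h2 ix Ux F"
  \<comment> \<open>\<open>e t\<close> is the Fourier multiplier of the translation by the ship's
    displacement \<open>Ux * t\<close>, so stationarity reads \<mu> t = \<mu> 0 * e t.\<close>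
  define e where "e = (\<lambda>t \<kappa>. exp (- \<i> * complex_of_real (a \<kappa> * t)))"
  have e: "exp (- 2 * pi * \<i> * complex_of_real (\<kappa> $ ix * Ux * t)) = e t \<kappa>" for t \<kappa>
    by (simp add: e_def a_def mult_ac)
  have e0: "e 0 \<kappa> = 1" and norm_e: "norm (e t \<kappa>) = 1" for t \<kappa>
    by (simp_all add: e_def)
  have star: "\<mu>_star t \<kappa> = d \<kappa> / (\<i> * (complex_of_real (a \<kappa>) + w \<kappa>)) * e t \<kappa>" for t \<kappa>
    unfolding \<mu>_star_def e by (simp add: d_def a_def)
  \<comment> \<open>Both \<omega> and \<open>a\<close> are real, at every \<kappa>. This identity
    yields the nonzero denominator, its lower bound \<epsilon> in norm, and the decay of the free
    oscillation.\<close>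
  have Im: "Im (complex_of_real (a \<kappa>) + w \<kappa>) = \<epsilon>" for \<kappa>
    by (simp add: w_def omega_eps_def)
  then have nz: "complex_of_real (a \<kappa>) + w \<kappa> \<noteq> 0" for \<kappa>
    using \<open>0 < \<epsilon>\<close> by (metis less_irrefl zero_complex.simps(2))
  have src: "source \<rho>1 \<rho>2 h1 h2 U X F t \<kappa> = d \<kappa> * e t \<kappa>" for t \<kappa>
    unfolding e[symmetric] by (simp add: source_def d_def D_def U_def X_def inner_axis mult_ac)
  have int: "integral {0..t} (\<lambda>\<tau>. exp (\<i> * w \<kappa> * complex_of_real (t - \<tau>)) * source \<rho>1 \<rho>2 h1 h2 U X F \<tau> \<kappa>)
      = \<mu>_star 0 \<kappa> * (exp (\<i> * w \<kappa> * complex_of_real t) - e t \<kappa>)" if "0 \<le> t" for t \<kappa>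
    using integral_duhamel_oscillation[OF nz that, of \<kappa> "d \<kappa>"]
    unfolding src star e0 by (simp add: e_def)
  have star_t: "\<mu>_star t \<kappa> = \<mu>_star 0 \<kappa> * e t \<kappa>" for t \<kappa>
    by (simp add: star e0)
  have L2F: "L2 F" using \<open>fourier_L2 f F\<close> by (simp add: fourier_L2_def)
  have "L2 (\<mu>_star 0)"
  \<comment> \<open>The constant combines the bound \<open>\<bar>Ux\<bar> / h1\<close> for the
    multiplier in \<open>D\<close> with 1 / \<epsilon> from the resonance denominator.\<close>
  proof (rule L2_bounded_by[OF L2F, where C = "\<bar>Ux\<bar> / h1 / \<epsilon>"])
    have "(\<lambda>\<kappa>. complex_of_real (a \<kappa>)) \<in> borel_measurable lebesgue"
      unfolding a_def by (rule measurable_lebesgue_of_borel) measurable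
    moreover have "d \<in> borel_measurable lebesgue"
      using L2F D_measurable by (auto simp: L2_def d_def)
    moreover have "w \<in> borel_measurable lebesgue"
      unfolding w_def by (rule omega_eps_measurable)
    ultimately have "(\<lambda>\<kappa>. d \<kappa> / (\<i> * (complex_of_real (a \<kappa>) + w \<kappa>))) \<in> borel_measurable lebesgue"
      by (intro borel_measurable_divide borel_measurable_times borel_measurable_add) auto
    then show "\<mu>_star 0 \<in> borel_measurable lebesgue"
      by (simp add: star e0 cong: measurable_cong)
    fix \<kappa>
    have "\<epsilon> \<le> norm (complex_of_real (a \<kappa>) + w \<kappa>)"
      using abs_Im_le_cmod[of "complex_of_real (a \<kappa>) + w \<kappa>"] Im[of \<kappa>] by linarith
    moreover have "norm (d \<kappa>) \<le> \<bar>Ux\<bar> / h1 * norm (F \<kappa>)"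
      unfolding d_def using assms by (intro norm_D_le) auto
    ultimately have "norm (d \<kappa>) / norm (complex_of_real (a \<kappa>) + w \<kappa>) \<le> \<bar>Ux\<bar> / h1 * norm (F \<kappa>) / \<epsilon>"
      using \<open>0 < \<epsilon>\<close> by (intro frac_le) (auto intro: order_trans[OF norm_ge_zero])
    then show "norm (\<mu>_star 0 \<kappa>) \<le> \<bar>Ux\<bar> / h1 / \<epsilon> * norm (F \<kappa>)"
      by (simp add: star e0 norm_divide norm_mult)
  qed
  then have "duhamel_solution w (source \<rho>1 \<rho>2 h1 h2 U X F) \<mu>_star"
    unfolding duhamel_solution_def
  proof (intro conjI allI impI AE_I2)
    fix t :: real and \<kappa> assume "0 \<le> t"
    \<comment> \<open>After inserting \<open>int\<close> the free oscillations cancel, leaving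
      \<open>\<mu>_star 0 \<kappa> * e t \<kappa>\<close>; this holds at every \<kappa>.\<close>
    show "\<mu>_star t \<kappa> = \<mu>_star 0 \<kappa> * exp (\<i> * w \<kappa> * complex_of_real t)
        - integral {0..t} (\<lambda>\<tau>. exp (\<i> * w \<kappa> * complex_of_real (t - \<tau>)) * source \<rho>1 \<rho>2 h1 h2 U X F \<tau> \<kappa>)"
      unfolding int[OF \<open>0 \<le> t\<close>] star_t[of t] by (simp only: right_diff_distrib) simp
  qed
  moreover have "stationary ix Ux \<mu>_star"
    unfolding stationary_def e by (intro allI impI AE_I2) (rule star_t)
  moreover have "AE \<kappa> in lebesgue. \<mu> t \<kappa> = \<mu>_star t \<kappa>"
    if sol: "duhamel_solution w (source \<rho>1 \<rho>2 h1 h2 U X F) \<mu>" and stat: "stationary ix Ux \<mu>"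
      and "0 \<le> t" for \<mu> t
  proof -
    have st: "AE \<kappa> in lebesgue. \<mu> s \<kappa> = \<mu> 0 \<kappa> * e s \<kappa>" if "0 \<le> s" for s
      using stat that unfolding stationary_def e by blast
    have du: "AE \<kappa> in lebesgue. \<mu> 1 \<kappa> = \<mu> 0 \<kappa> * exp (\<i> * w \<kappa> * complex_of_real 1)
        - \<mu>_star 0 \<kappa> * (exp (\<i> * w \<kappa> * complex_of_real 1) - e 1 \<kappa>)"
      using conjunct2[OF sol[unfolded duhamel_solution_def], rule_format, OF zero_le_one]
      unfolding int[OF zero_le_one] .
    \<comment> \<open>Outside three null sets, the two conditions at time 1 fix \<mu> 0, and
      stationarity carries the equality to time t.\<close>
    show ?thesis
      using st[OF \<open>0 \<le> t\<close>] st[OF zero_le_one] du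
    proof eventually_elim
      case (elim \<kappa>)
      let ?z = "exp (\<i> * w \<kappa> * complex_of_real 1)"
      \<comment> \<open>The modulus of \<open>?z\<close> is exp(- \<epsilon>), while
        \<open>e 1 \<kappa>\<close> lies on the unit circle.\<close>
      have "norm ?z < 1" using \<open>0 < \<epsilon>\<close> Im[of \<kappa>] by (simp add: norm_exp)
      then have "?z - e 1 \<kappa> \<noteq> 0" using norm_e[of 1 \<kappa>] by (metis eq_iff_diff_eq_0 less_irrefl)
      \<comment> \<open>Eliminating \<mu> 1 between stationarity and Duhamel's formula leaves this
        linear equation for \<mu> 0.\<close>
      moreover have "(\<mu> 0 \<kappa> - \<mu>_star 0 \<kappa>) * (?z - e 1 \<kappa>) = 0"
        using elim(2,3) by (simp add: algebra_simps)
      ultimately have "\<mu> 0 \<kappa> = \<mu>_star 0 \<kappa>" by simp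
      then show ?case using elim(1) by (simp add: star_t[of t])
    qed
  qed
  ultimately show ?thesis by blast
qed

end
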